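(* Let $N \ge 2$ and let $\mathbf{X}, \mathbf{Y} \in \mathbb{R}^{I \times J}$ be real matrices given as matrix chains (products) $\mathbf{X} = \mathbf{A}_1 \mathbf{A}_2 \cdots \mathbf{A}_N$ and $\mathbf{Y} = \mathbf{B}_1 \mathbf{B}_2 \cdots \mathbf{B}_N$ of the same length $N$, where $\mathbf{A}_n \in \mathbb{R}^{R_{n-1} \times R_n}$ and $\mathbf{B}_n \in \mathbb{R}^{S_{n-1} \times S_n}$ for $n = 1, \dots, N$, with $R_0 = S_0 = I$ and $R_N = S_N = J$; the inner (contracting) dimensions $R_n$ and $S_n$, $1 \le n \le N-1$, are not required to be equal. Define the block matrices $$\mathbf{C}_1 = \begin{bmatrix} \mathbf{A}_1 & \mathbf{B}_1 \end{bmatrix} \in \mathbb{R}^{I \times (R_1 + S_1)}, \qquad \mathbf{C}_n = \begin{bmatrix} \mathbf{A}_n & \mathbf{0} \\ \mathbf{0} & \mathbf{B}_n \end{bmatrix} \in \mathbb{R}^{(R_{n-1}+S_{n-1}) \times (R_n + S_n)} \quad (2 \le n \le N-1), \qquad \mathbf{C}_N = \begin{bmatrix} \mathbf{A}_N \\ \mathbf{B}_N \end{bmatrix} \in \mathbb{R}^{(R_{N-1}+S_{N-1}) \times J}.$$ Then $$\mathbf{C}_1 \mathbf{C}_2 \cdots \mathbf{C}_N = \mathbf{X} + \mathbf{Y}.$$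
   Context: All matrices are real and all dimensions are positive integers. When $N = 2$ there are no intermediate factors, and the product is $\mathbf{C}_1 \mathbf{C}_2$. *)

theory Defs
  imports Complex_Main "Jordan_Normal_Form.Matrix"
begin

text \<open>Factors are indexed from 1, and the product is bracketed to the left. It is only
  meaningful for \<open>N \<ge> 1\<close> (\<^term>\<open>N = (0::nat)\<close> gives the junk value \<open>A 1\<close>).\<close>

definition mat_chain :: "(nat \<Rightarrow> 'a :: semiring_0 mat) \<Rightarrow> nat \<Rightarrow> 'a mat" where
  "mat_chain A N = foldl (*) (A 1) (map A [2..<Suc N])"

lemma mat_chain_1: "mat_chain A 1 = A 1"
  by (simp add: mat_chain_def)

lemma mat_chain_Suc: "N \<ge> 1 \<Longrightarrow> mat_chain A (Suc N) = mat_chain A N * A (Suc N)"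
  by (simp add: mat_chain_def)

text \<open>The block row \<open>[A B]\<close>, the counterpart of \<^const>\<open>append_rows\<close>.\<close>

definition append_cols :: "'a :: zero mat \<Rightarrow> 'a mat \<Rightarrow> 'a mat" (infixr \<open>@\<^sub>c\<close> 65) where
  "A @\<^sub>c B = four_block_mat A B (0\<^sub>m 0 (dim_col A)) (0\<^sub>m 0 (dim_col B))"

lemma carrier_append_cols [simp, intro]:
  "A \<in> carrier_mat nr nc1 \<Longrightarrow> B \<in> carrier_mat nr nc2 \<Longrightarrow> A @\<^sub>c B \<in> carrier_mat nr (nc1 + nc2)"
  unfolding append_cols_def by auto

lemma index_append_cols:
  assumes "A \<in> carrier_mat nr nc1" "B \<in> carrier_mat nr nc2" "i < nr" "j < nc1 + nc2"
  shows "(A @\<^sub>c B) $$ (i, j) = (if j < nc1 then A $$ (i, j) else B $$ (i, j - nc1))"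
  using assms unfolding append_cols_def by auto

end

theory Submission
  imports Defs
begin

text \<open>Block multiplication makes the two chains run side by side without interacting. A block
  row times a block diagonal matrix is again a block row,
  \<open>[P Q] * diag(A, B) = [P*A Q*B]\<close> (\<open>append_cols_mult_block_diag\<close>), so by
  induction every proper prefix of the chain of the \<open>C n\<close> is the block row of the
  corresponding prefixes of \<open>A\<close> and \<open>B\<close>
  (\<open>mat_chain_block_diag\<close>). Only the last factor, a block column, mixes the two halves:
  \<open>[P Q]\<close> times it is \<open>P*A + Q*B\<close>
  (\<open>append_cols_mult_append_rows\<close>), which turns the pair of products into their
  sum.\<close>

lemma append_cols_mult_append_rows:
  fixes A B C D :: "'a :: semiring_0 mat"
  assumes A: "A \<in> carrier_mat nr n1" and B: "B \<in> carrier_mat nr n2"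
    and C: "C \<in> carrier_mat n1 nc" and D: "D \<in> carrier_mat n2 nc"
  shows "(A @\<^sub>c B) * (C @\<^sub>r D) = A * C + B * D"
proof -
  \<comment> \<open>Padding with blocks that have no rows or no columns turns both factors into 2 x
    2 block matrices, so \<open>mult_four_block_mat\<close> applies.\<close>
  have "(A @\<^sub>c B) * (C @\<^sub>r D) =
      four_block_mat A B (0\<^sub>m 0 n1) (0\<^sub>m 0 n2) * four_block_mat C (0\<^sub>m n1 0) D (0\<^sub>m n2 0)"
    using assms by (simp add: append_cols_def append_rows_def)
  also have "\<dots> = four_block_mat (A * C + B * D) (A * 0\<^sub>m n1 0 + B * 0\<^sub>m n2 0)
      (0\<^sub>m 0 n1 * C + 0\<^sub>m 0 n2 * D) (0\<^sub>m 0 n1 * 0\<^sub>m n1 0 + 0\<^sub>m 0 n2 * 0\<^sub>m n2 0)"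
    using assms by (intro mult_four_block_mat) auto
  \<comment> \<open>The lower blocks have no rows and the right blocks no columns, so every index
    lies in the upper left block.\<close>
  also have "\<dots> = A * C + B * D"
    using assms by (intro eq_matI) auto
  finally show ?thesis .
qed

lemma append_cols_mult_block_diag:
  fixes A B C D :: "'a :: semiring_0 mat"
  assumes A: "A \<in> carrier_mat nr n1" and B: "B \<in> carrier_mat nr n2"
    and C: "C \<in> carrier_mat n1 m1" and D: "D \<in> carrier_mat n2 m2"
  shows "(A @\<^sub>c B) * four_block_mat C (0\<^sub>m n1 m2) (0\<^sub>m n2 m1) D = (A * C) @\<^sub>c (B * D)"
proof -
  have "(A @\<^sub>c B) * four_block_mat C (0\<^sub>m n1 m2) (0\<^sub>m n2 m1) D =
      four_block_mat A B (0\<^sub>m 0 n1) (0\<^sub>m 0 n2) * four_block_mat C (0\<^sub>m n1 m2) (0\<^sub>m n2 m1) D"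
    using assms by (simp add: append_cols_def)
  also have "\<dots> = four_block_mat (A * C + B * 0\<^sub>m n2 m1) (A * 0\<^sub>m n1 m2 + B * D)
      (0\<^sub>m 0 n1 * C + 0\<^sub>m 0 n2 * 0\<^sub>m n2 m1) (0\<^sub>m 0 n1 * 0\<^sub>m n1 m2 + 0\<^sub>m 0 n2 * D)"
    using assms by (intro mult_four_block_mat) auto
  \<comment> \<open>Block by block: the off-diagonal zeros remove the cross terms above, and the
    lower blocks are empty.\<close>
  also have "\<dots> = (A * C) @\<^sub>c (B * D)"
    using assms unfolding append_cols_def by (intro cong_four_block_mat) auto
  finally show ?thesis .
qed

lemma mat_chain_carrier:
  assumes "1 \<le> k" and "\<And>n. 1 \<le> n \<Longrightarrow> n \<le> k \<Longrightarrow> A n \<in> carrier_mat (R (n - 1)) (R n)"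
  shows "mat_chain A k \<in> carrier_mat (R 0) (R k)"
  using assms
proof (induction k rule: dec_induct)
  case base
  then show ?case using base(1)[of 1] by (simp add: mat_chain_def)
next
  case (step k)
  have "mat_chain A k \<in> carrier_mat (R 0) (R k)"
    using step by simp
  moreover have "A (Suc k) \<in> carrier_mat (R k) (R (Suc k))"
    using step.prems[of "Suc k"] by simp
  ultimately show ?case
    using mat_chain_Suc[OF step.hyps(1), of A] by simp
qed

text \<open>This is the invariant for prefixes that stop before the closing block column. The
  left-bracketed product lets each induction step append one block diagonal factor on the
  right.\<close>

lemma mat_chain_block_diag:
  assumes "1 \<le> k"
    and "\<And>n. 1 \<le> n \<Longrightarrow> n \<le> k \<Longrightarrow> A n \<in> carrier_mat (R (n - 1)) (R n)"
    and "\<And>n. 1 \<le> n \<Longrightarrow> n \<le> k \<Longrightarrow> B n \<in> carrier_mat (S (n - 1)) (S n)"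
    and "R 0 = S 0"
    and "C 1 = A 1 @\<^sub>c B 1"
    and "\<And>n. 2 \<le> n \<Longrightarrow> n \<le> k \<Longrightarrow>
           C n = four_block_mat (A n) (0\<^sub>m (R (n - 1)) (S n)) (0\<^sub>m (S (n - 1)) (R n)) (B n)"
  shows "mat_chain C k = mat_chain A k @\<^sub>c mat_chain B k"
  using assms
proof (induction k rule: dec_induct)
  case base
  then show ?case by (simp add: mat_chain_def)
next
  case (step k)
  have IH: "mat_chain C k = mat_chain A k @\<^sub>c mat_chain B k"
    using step by simp
  \<comment> \<open>The row count of the second prefix is written as \<open>R 0\<close> instead of
    \<open>S 0\<close>, since a block row needs a common height.\<close>
  have A: "mat_chain A k \<in> carrier_mat (R 0) (R k)"
    and B: "mat_chain B k \<in> carrier_mat (R 0) (S k)"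
    using mat_chain_carrier[of k A R] mat_chain_carrier[of k B S] step.hyps step.prems by simp_all
  have A': "A (Suc k) \<in> carrier_mat (R k) (R (Suc k))"
    and B': "B (Suc k) \<in> carrier_mat (S k) (S (Suc k))"
    using step.prems(1)[of "Suc k"] step.prems(2)[of "Suc k"] by simp_all
  have "C (Suc k) = four_block_mat (A (Suc k)) (0\<^sub>m (R k) (S (Suc k))) (0\<^sub>m (S k) (R (Suc k))) (B (Suc k))"
    using step.prems(5)[of "Suc k"] step.hyps by simp
  then show ?case
    using append_cols_mult_block_diag[OF A B A' B'] step.hyps by (simp add: mat_chain_Suc IH)
qed

theorem proposition1:
  fixes N I J :: nat
    and R S :: "nat \<Rightarrow> nat"
    and A B C :: "nat \<Rightarrow> real mat"
    and X Y :: "real mat"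
  assumes "N \<ge> 2"
    and "I > 0" and "J > 0"
    and "\<And>n. n \<le> N \<Longrightarrow> R n > 0"
    and "\<And>n. n \<le> N \<Longrightarrow> S n > 0"
    and "R 0 = I" and "S 0 = I" and "R N = J" and "S N = J"
    and "\<And>n. 1 \<le> n \<Longrightarrow> n \<le> N \<Longrightarrow> A n \<in> carrier_mat (R (n - 1)) (R n)"
    and "\<And>n. 1 \<le> n \<Longrightarrow> n \<le> N \<Longrightarrow> B n \<in> carrier_mat (S (n - 1)) (S n)"
    and "X \<in> carrier_mat I J" and "Y \<in> carrier_mat I J"
    and "X = mat_chain A N"
    and "Y = mat_chain B N"
    and "C 1 = A 1 @\<^sub>c B 1"
    and "\<And>n. 2 \<le> n \<Longrightarrow> n \<le> N - 1 \<Longrightarrow>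
           C n = four_block_mat (A n) (0\<^sub>m (R (n - 1)) (S n)) (0\<^sub>m (S (n - 1)) (R n)) (B n)"
    and "C N = A N @\<^sub>r B N"
  shows "mat_chain C N = X + Y"
proof -
  \<comment> \<open>The last factor is split off. As \<open>N\<close> is at least 2, the remaining
    prefix is nonempty; for \<open>N = 2\<close> it is just \<open>C 1\<close>, the base case of the
    invariant.\<close>
  obtain k where N: "N = Suc k" and k: "1 \<le> k"
    using assms(1) by (cases N) auto
  have C: "mat_chain C k = mat_chain A k @\<^sub>c mat_chain B k"
    by (rule mat_chain_block_diag[where R = R and S = S]) (use assms k N in auto)
  have A: "mat_chain A k \<in> carrier_mat I (R k)" and B: "mat_chain B k \<in> carrier_mat I (S k)"
    using mat_chain_carrier[of k A R] mat_chain_carrier[of k B S] assms k N by simp_all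
  have A': "A N \<in> carrier_mat (R k) J" and B': "B N \<in> carrier_mat (S k) J"
    using assms(8-11) N by (metis diff_Suc_1 le_add1 order_refl plus_1_eq_Suc)+
  have "mat_chain C N = (mat_chain A k @\<^sub>c mat_chain B k) * (A N @\<^sub>r B N)"
    using mat_chain_Suc[OF k, of C] C assms(18) N by simp
  also have "\<dots> = mat_chain A k * A N + mat_chain B k * B N"
    by (rule append_cols_mult_append_rows[OF A B A' B'])
  also have "\<dots> = X + Y"
    using assms(14,15) N k by (simp add: mat_chain_Suc)
  finally show ?thesis .
qed

end
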